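(* Assume that $\mu(t)\to 0$ as $t\to\infty$ and that $\mu(t)$ is eventually non-increasing. Let $f$ be a function which is regularly varying at $\infty$ with index $\alpha\ge 1$ and satisfies $t/f(t)\to 0$ as $t\to\infty$. If there is some $\rho\in\mathbb{R}$ such that for all $c>0$ \[ \sum_{i=1}^n\log\bigl(\mu(ic)\bigr)\ \sim\ -c^{\rho} f(n)\qquad\text{as } n\to\infty, \] then $\mathbb{P}(D>t)\approx_{\log} \mathrm{e}^{-\ell^{\rho-\alpha} f(t)}$ as $t\to\infty$.
   Context: Let $\ell>0$ be fixed. $\mathcal N$ is an inhomogeneous Poisson point process on $(0,\infty)$ with rate function $\mu(t)$, i.e. with intensity measure $\mu(t)\,\mathrm{d}t$; write $M(a,b)=\int_a^b\mu(t)\,\mathrm{d}t$. It is assumed that $M(0,t)<\infty$ for every finite $t$ and that $\mu(t)>0$ for Lebesgue-almost all $t\ge 0$. Let $0<T_1<T_2<\cdots$ be the epochs (points) of $\mathcal N$, with $T_0=0$ by convention; if $\mathcal N$ has only finitely many points, say $n$ of them, then $T_{n+1}=\infty$. Define $D=\min\{T_n:\ n\ge 0,\ T_{n+1}-T_n\ge \ell\}$, with $D=\infty$ if there is no such $n$. The relation $a(x)\sim b(x)$ means $a(x)/b(x)\to 1$, and $a(x)\approx_{\log} b(x)$ means $\log a(x)/\log b(x)\to 1$. *)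

theory Defs
  imports "HOL-Probability.Probability" "HOL-Library.Landau_Symbols"
begin

definition intensity :: "(real \<Rightarrow> real) \<Rightarrow> real set \<Rightarrow> ennreal" where
  "intensity \<mu> B = (\<integral>\<^sup>+ t\<in>B. ennreal (\<mu> t) \<partial>lebesgue)"

text \<open>A rate function on the half-line. Its values at non-positive arguments are irrelevant.\<close>

definition rate_function :: "(real \<Rightarrow> real) \<Rightarrow> bool" where
  "rate_function \<mu> \<longleftrightarrow>
     \<mu> \<in> borel_measurable (lebesgue_on {0<..}) \<and> (\<forall>t>0. 0 \<le> \<mu> t)"

definition num_points :: "real set \<Rightarrow> real set \<Rightarrow> ennreal" where
  "num_points S B = emeasure (count_space UNIV) (S \<inter> B)"

text \<open>
  A Poisson process is modelled as a random set of points (an atomless intensity gives simple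
  points). Local finiteness on bounded intervals is required for every outcome, so
  that the points can always be enumerated in increasing order.
\<close>

definition poisson_process ::
    "'a measure \<Rightarrow> ('a \<Rightarrow> real set) \<Rightarrow> (real \<Rightarrow> real) \<Rightarrow> bool" where
  "poisson_process P N \<mu> \<longleftrightarrow>
     prob_space P \<and>
     (\<forall>\<omega>\<in>space P. N \<omega> \<subseteq> {0<..} \<and> (\<forall>t. finite (N \<omega> \<inter> {0<..t}))) \<and>
     (\<forall>B\<in>sets borel. B \<subseteq> {0<..} \<longrightarrow>
        (\<lambda>\<omega>. num_points (N \<omega>) B) \<in> borel_measurable P \<and>
        (intensity \<mu> B < \<infinity> \<longrightarrow>
          (\<forall>k::nat. measure P {\<omega> \<in> space P. num_points (N \<omega>) B = of_nat k} =
             enn2real (intensity \<mu> B) ^ k / fact k * exp (- enn2real (intensity \<mu> B)))) \<and>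
        (intensity \<mu> B = \<infinity> \<longrightarrow> (AE \<omega> in P. num_points (N \<omega>) B = \<infinity>))) \<and>
     (\<forall>B :: nat \<Rightarrow> real set. (\<forall>i. B i \<in> sets borel \<and> B i \<subseteq> {0<..}) \<and> disjoint_family B \<longrightarrow>
        prob_space.indep_vars P (\<lambda>_. borel) (\<lambda>i \<omega>. num_points (N \<omega>) (B i)) UNIV)"

text \<open>
  If \<open>S\<close> has exactly \<open>n\<close> points, then \<open>epoch S k = \<infinity>\<close> for all \<open>k > n\<close>, because the infimum of
  the empty set is \<open>\<infinity>\<close>.
\<close>

fun epoch :: "real set \<Rightarrow> nat \<Rightarrow> ereal" where
  "epoch S 0 = 0"
| "epoch S (Suc n) = Inf {ereal s | s. s \<in> S \<and> epoch S n < ereal s}"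

text \<open>
  The epochs are non-decreasing, so the infimum is a minimum when the set is non-empty; it is
  \<open>\<infinity>\<close> when the set is empty. The condition \<open>epoch S n < \<infinity>\<close> excludes the meaningless
  difference \<open>\<infinity> - \<infinity>\<close>, which would be \<open>\<infinity>\<close> in type \<^typ>\<open>ereal\<close>.
\<close>

definition first_gap :: "real \<Rightarrow> real set \<Rightarrow> ereal" where
  "first_gap L S =
     Inf {epoch S n | n. epoch S n < \<infinity> \<and> epoch S (Suc n) - epoch S n \<ge> ereal L}"

definition regularly_varying :: "(real \<Rightarrow> real) \<Rightarrow> real \<Rightarrow> bool" where
  "regularly_varying f \<alpha> \<longleftrightarrow>
     (\<exists>X. f \<in> borel_measurable (lebesgue_on {X..}) \<and> (\<forall>t\<ge>X. 0 < f t)) \<and>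
     (\<forall>x>0. ((\<lambda>t. f (x * t) / f t) \<longlongrightarrow> x powr \<alpha>) at_top)"

definition log_equiv :: "(real \<Rightarrow> real) \<Rightarrow> (real \<Rightarrow> real) \<Rightarrow> bool" where
  "log_equiv a b \<longleftrightarrow> ((\<lambda>t. ln (a t) / ln (b t)) \<longlongrightarrow> 1) at_top"

end

theory Submission
  imports Defs
begin

text \<open>
  The event \<open>D > t\<close> says that every gap that begins up to time \<open>t\<close> is shorter than \<open>L\<close>. When the rate
  tends to \<open>0\<close>, the cheapest way to achieve this is to place one point roughly every \<open>L\<close> time units,
  and each such point costs about a factor \<open>\<mu> (i * L)\<close>. Hence \<open>P (D > t)\<close> is, up to factors that are
  exponential in \<open>t\<close>, the product of \<open>\<mu> (i * L)\<close> for \<open>i \<le> t / L\<close>. The logarithm of this product is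
  asymptotic to \<open>- (L powr \<rho>) * f (t / L)\<close>, hence to \<open>- (L powr (\<rho> - \<alpha>)) * f t\<close>, and exponential
  factors do not matter because \<open>t / f t\<close> tends to \<open>0\<close>.

  Two inclusions make this precise. If \<open>D > t\<close>, then every block \<open>(i * L, (i + 1) * L]\<close> that starts up
  to time \<open>t\<close> contains a point (lemma \<open>tail_prob_upper\<close>). Conversely, if \<open>L = c + d\<close> with a small
  \<open>d > 0\<close> and every window \<open>(i * c - d, i * c]\<close> up to slightly beyond \<open>t\<close> contains a point, then
  \<open>D > t\<close> (lemma \<open>tail_prob_lower\<close>). In both cases independence on disjoint sets yields a product. The
  first gives the exponent with the right constant, the second with \<open>c\<close> in place of \<open>L\<close>, and one lets
  \<open>c\<close> tend to \<open>L\<close> from below.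

  Two points need more care than this sketch suggests. The set \<open>D > t\<close> must be shown to be an event;
  lemma \<open>first_gap_gt_iff_windows\<close> expresses it by countably many hitting events. Moreover the
  hypothesis on the sums concerns \<open>f\<close> at integers, whereas the conclusion concerns it at real
  arguments, and the passage from \<open>\<lfloor>t / c\<rfloor>\<close> to \<open>t / c\<close> needs the uniform convergence theorem for
  measurable regularly varying functions (lemma \<open>log_regular_variation_uniform\<close>).
\<close>

section \<open>Epochs and the first large gap of a locally finite set\<close>

text \<open>
  The standing property of every outcome of the process. It makes infima over sets of points
  minima, and it lets the epochs enumerate all points in increasing order.
\<close>
definition locally_finite_points :: "real set \<Rightarrow> bool" where
  "locally_finite_points S \<longleftrightarrow> S \<subseteq> {0<..} \<and> (\<forall>t. finite (S \<inter> {0<..t}))"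

lemma finite_points_atMost:
  assumes "locally_finite_points S"
  shows "finite (insert 0 S \<inter> {..t})"
proof -
  have "insert 0 S \<inter> {..t} \<subseteq> insert 0 (S \<inter> {0<..t})"
    using assms by (auto simp: locally_finite_points_def)
  moreover have "finite (S \<inter> {0<..t})" using assms by (simp add: locally_finite_points_def)
  ultimately show ?thesis by (meson finite_insert finite_subset)
qed

text \<open>
  Below any of its elements the set has only finitely many others, so the infimum is a minimum.
  Both the epochs and the first gap are such infima.
\<close>
lemma Inf_points_attained:
  assumes S: "locally_finite_points S" and A: "A \<subseteq> ereal ` insert 0 S" and fin: "Inf A < \<infinity>"
  shows "Inf A \<in> A"
proof -
  have "A \<noteq> {}" using fin by (auto simp: top_ereal_def)
  then obtain s where s: "s \<in> insert 0 S" "ereal s \<in> A" using A by blast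
  let ?F = "A \<inter> {..ereal s}"
  have "?F \<subseteq> ereal ` (insert 0 S \<inter> {..s})" using A by auto
  then have F: "finite ?F"
    using finite_points_atMost[OF S] by (meson finite_imageI finite_subset)
  have ne: "?F \<noteq> {}" using s by auto
  have le: "Min ?F \<le> a" if "a \<in> A" for a
  proof (cases "a \<le> ereal s")
    case True then show ?thesis using that F by (auto intro: Min_le)
  next
    case False
    have "Min ?F \<le> ereal s" using F s by (intro Min_le) auto
    then show ?thesis using False by auto
  qed
  have mem: "Min ?F \<in> A" using Min_in[OF F ne] by blast
  have "Inf A = Min ?F"
    using le mem by (intro antisym Inf_lower Inf_greatest)
  then show ?thesis using mem by simp
qed

text \<open>
  Unfolding the infimum would hide the successor epoch behind a set comprehension.
\<close>
declare epoch.simps(2) [simp del]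

lemma epoch_Suc_finite:
  assumes S: "locally_finite_points S" and fin: "epoch S (Suc n) < \<infinity>"
  shows "\<exists>s\<in>S. epoch S (Suc n) = ereal s \<and> epoch S n < ereal s"
proof -
  have "Inf {ereal s | s. s \<in> S \<and> epoch S n < ereal s} \<in> {ereal s | s. s \<in> S \<and> epoch S n < ereal s}"
    using S fin by (intro Inf_points_attained) (auto simp: epoch.simps(2))
  then show ?thesis by (auto simp: epoch.simps(2))
qed

lemma epoch_finite_in_points:
  assumes S: "locally_finite_points S" and fin: "epoch S n < \<infinity>"
  shows "epoch S n \<in> ereal ` insert 0 S"
proof (cases n)
  case (Suc m)
  then show ?thesis using epoch_Suc_finite[OF S, of m] fin by auto
qed auto

lemma epoch_Suc_le: "s \<in> S \<Longrightarrow> epoch S n < ereal s \<Longrightarrow> epoch S (Suc n) \<le> ereal s"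
  by (auto simp: epoch.simps(2) intro: Inf_lower)

text \<open>
  Otherwise the epochs would form an infinite strictly increasing sequence of points in a bounded
  interval.
\<close>
lemma ex_epoch_gt:
  assumes S: "locally_finite_points S"
  shows "\<exists>n. epoch S n > ereal a"
proof (rule ccontr)
  assume "\<not> ?thesis"
  then have le: "epoch S n \<le> ereal a" for n by (simp add: not_less)
  have fin: "epoch S n < \<infinity>" for n using le[of n] by auto
  have "epoch S n < epoch S (Suc n)" for n
    using epoch_Suc_finite[OF S fin] by metis
  then have "strict_mono (epoch S)" by (intro strict_mono_Suc_iff[THEN iffD2]) auto
  then have "infinite (range (epoch S))"
    by (simp add: strict_mono_imp_inj_on range_inj_infinite)
  moreover have "range (epoch S) \<subseteq> ereal ` (insert 0 S \<inter> {..a})"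
  proof clarify
    fix n
    obtain x where "x \<in> insert 0 S" "epoch S n = ereal x"
      using epoch_finite_in_points[OF S fin] by blast
    then show "epoch S n \<in> ereal ` (insert 0 S \<inter> {..a})" using le[of n] by auto
  qed
  ultimately show False
    using finite_points_atMost[OF S, of a] by (meson finite_imageI finite_subset)
qed

text \<open>
  A point that no epoch hits would, by induction, stay above all epochs: the next epoch is the
  least point beyond the current one, so it cannot jump over a point.
\<close>
lemma points_are_epochs:
  assumes S: "locally_finite_points S" and x: "x \<in> insert 0 S"
  shows "\<exists>n. epoch S n = ereal x"
proof (rule ccontr)
  assume none: "\<not> ?thesis"
  have "x \<noteq> 0" using none by (metis epoch.simps(1) zero_ereal_def)
  then have xS: "x \<in> S" "0 < x" using x S by (auto simp: locally_finite_points_def)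
  have "epoch S n < ereal x" for n
  proof (induction n)
    case 0 then show ?case using xS by (simp add: zero_ereal_def)
  next
    case (Suc n)
    then show ?case using epoch_Suc_le[OF xS(1)] none by (meson order_le_imp_less_or_eq)
  qed
  then show False using ex_epoch_gt[OF S, of x] by (metis less_asym)
qed

text \<open>
  Removes the enumeration of the points: what matters is only that every point up to \<open>t\<close>, the
  origin included, has another point strictly within distance \<open>L\<close> to its right.
\<close>
lemma first_gap_gt_iff:
  assumes S: "locally_finite_points S"
  shows "first_gap L S > ereal t \<longleftrightarrow> (\<forall>x\<in>insert 0 S \<inter> {..t}. \<exists>y\<in>S. x < y \<and> y < x + L)"
    (is "_ \<longleftrightarrow> ?R")
proof
  let ?G = "{epoch S n | n. epoch S n < \<infinity> \<and> epoch S (Suc n) - epoch S n \<ge> ereal L}"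
  assume gt: "first_gap L S > ereal t"
  show ?R
  proof
    fix x assume x: "x \<in> insert 0 S \<inter> {..t}"
    obtain n where n: "epoch S n = ereal x" using points_are_epochs[OF S] x by blast
    have "epoch S n \<notin> ?G"
    proof
      assume "epoch S n \<in> ?G"
      then have "first_gap L S \<le> epoch S n" unfolding first_gap_def by (rule Inf_lower)
      then have "first_gap L S \<le> ereal t" using n x by (auto intro: order_trans)
      then show False using gt by simp
    qed
    moreover have "epoch S n < \<infinity>" using n by simp
    ultimately have "\<not> (epoch S (Suc n) - epoch S n \<ge> ereal L)" by blast
    then have less: "epoch S (Suc n) - ereal x < ereal L" using n by simp
    then have "epoch S (Suc n) < \<infinity>" by auto
    from epoch_Suc_finite[OF S this] obtain s where
      "s \<in> S" "epoch S (Suc n) = ereal s" "epoch S n < ereal s" by blast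
    then show "\<exists>y\<in>S. x < y \<and> y < x + L" using less n by (intro bexI[of _ s]) auto
  qed
next
  let ?G = "{epoch S n | n. epoch S n < \<infinity> \<and> epoch S (Suc n) - epoch S n \<ge> ereal L}"
  assume R: ?R
  show "first_gap L S > ereal t"
  proof (rule ccontr)
    assume "\<not> ?thesis"
    then have le: "Inf ?G \<le> ereal t" by (simp add: first_gap_def)
    have "Inf ?G \<in> ?G"
      using epoch_finite_in_points[OF S] le by (intro Inf_points_attained[OF S]) auto
    then obtain n where n: "Inf ?G = epoch S n" "epoch S n < \<infinity>"
      "epoch S (Suc n) - epoch S n \<ge> ereal L" by auto
    obtain x where x: "x \<in> insert 0 S" "epoch S n = ereal x"
      using epoch_finite_in_points[OF S n(2)] by auto
    have "x \<le> t" using le n(1) x(2) by simp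
    then obtain y where y: "y \<in> S" "x < y" "y < x + L" using R x(1) by blast
    have "epoch S (Suc n) \<le> ereal y" using y x by (intro epoch_Suc_le) auto
    then have "epoch S (Suc n) - epoch S n \<le> ereal y - ereal x"
      using x(2) by (simp only: ereal_minus_mono)
    also have "\<dots> < ereal L" using y by simp
    finally show False using n(3) by simp
  qed
qed

text \<open>
  There are finitely many points up to \<open>t\<close>, each with a successor strictly closer than \<open>L\<close>, so the
  gaps stay below \<open>L\<close> by a uniform margin \<open>e\<close>. A window of length \<open>L - e\<close> that starts at \<open>q\<close> then
  catches the successor of the last point up to \<open>q\<close>.
\<close>
lemma first_gap_gt_imp_windows_nonempty:
  assumes S: "locally_finite_points S" and gt: "first_gap L S > ereal t" and t: "0 \<le> t"
  obtains e where "0 < e" "\<And>q. 0 \<le> q \<Longrightarrow> q \<le> t \<Longrightarrow> S \<inter> {q<..q + L - e} \<noteq> {}"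
proof -
  let ?F = "insert 0 S \<inter> {..t}"
  have F: "finite ?F" by (rule finite_points_atMost[OF S])
  have "0 \<in> ?F" using t by simp
  from gt obtain y where y: "\<And>x. x \<in> ?F \<Longrightarrow> y x \<in> S \<and> x < y x \<and> y x < x + L"
    unfolding first_gap_gt_iff[OF S] by metis
  define e where "e = Min ((\<lambda>x. x + L - y x) ` ?F)"
  have e_le: "e \<le> x + L - y x" if "x \<in> ?F" for x
    unfolding e_def using F that by (intro Min_le) auto
  have e_in: "e \<in> (\<lambda>x. x + L - y x) ` ?F"
    unfolding e_def by (rule Min_in) (use F \<open>0 \<in> ?F\<close> in auto)
  then have "0 < e" using y by fastforce
  moreover have "S \<inter> {q<..q + L - e} \<noteq> {}" if q: "0 \<le> q" "q \<le> t" for q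
  proof -
    let ?H = "insert 0 S \<inter> {..q}"
    define x where "x = Max ?H"
    have H: "finite ?H" by (rule finite_points_atMost[OF S])
    have "x \<in> ?H" unfolding x_def by (rule Max_in) (use H q in auto)
    then have xF: "x \<in> ?F" and xq: "x \<le> q" using q by auto
    \<comment> \<open>the successor of the last point up to \<open>q\<close> lies beyond \<open>q\<close>\<close>
    have "q < y x"
    proof (rule ccontr)
      assume "\<not> q < y x"
      then have "y x \<in> ?H" using y[OF xF] by auto
      then have "y x \<le> x" unfolding x_def using H by (intro Max_ge)
      then show False using y[OF xF] by auto
    qed
    moreover have "y x \<le> q + L - e" using e_le[OF xF] xq by linarith
    ultimately show ?thesis using y[OF xF] by auto
  qed
  ultimately show thesis by (rule that)
qed

text \<open>
  A description by countably many conditions of the form ``the process hits a given interval''. It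
  makes \<open>D > t\<close> an event, which is essential for the lower bound, as the measure of a
  non-measurable set would be \<open>0\<close>. Rational window positions suffice because a window slightly
  to the right of a point \<open>x < t\<close>, shortened accordingly, still ends before \<open>x + L\<close>; the position
  \<open>t\<close> itself is added for a possible point at \<open>t\<close>.
\<close>
lemma first_gap_gt_iff_windows:
  assumes S: "locally_finite_points S" and t: "0 \<le> t"
  shows "first_gap L S > ereal t \<longleftrightarrow>
    (\<exists>k. \<forall>q\<in>insert t (\<rat> \<inter> {0..t}). S \<inter> {q<..q + L - 1 / Suc k} \<noteq> {})"
proof
  assume "first_gap L S > ereal t"
  from first_gap_gt_imp_windows_nonempty[OF S this t] obtain e where
    e: "0 < e" "\<And>q. 0 \<le> q \<Longrightarrow> q \<le> t \<Longrightarrow> S \<inter> {q<..q + L - e} \<noteq> {}" by blast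
  obtain k where k: "1 / Suc k < e"
    using e(1) nat_approx_posE by blast
  have "S \<inter> {q<..q + L - 1 / Suc k} \<noteq> {}" if "q \<in> insert t (\<rat> \<inter> {0..t})" for q
  proof -
    have "S \<inter> {q<..q + L - e} \<noteq> {}" using that t by (intro e(2)) auto
    moreover have "{q<..q + L - e} \<subseteq> {q<..q + L - 1 / Suc k}" using k by auto
    ultimately show ?thesis by blast
  qed
  then show "\<exists>k. \<forall>q\<in>insert t (\<rat> \<inter> {0..t}). S \<inter> {q<..q + L - 1 / Suc k} \<noteq> {}"
    by blast
next
  assume "\<exists>k. \<forall>q\<in>insert t (\<rat> \<inter> {0..t}). S \<inter> {q<..q + L - 1 / Suc k} \<noteq> {}"
  then obtain k where k: "\<And>q. q \<in> insert t (\<rat> \<inter> {0..t}) \<Longrightarrow> S \<inter> {q<..q + L - 1 / Suc k} \<noteq> {}"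
    by blast
  have k0: "0 < 1 / real (Suc k)" by simp
  show "first_gap L S > ereal t"
    unfolding first_gap_gt_iff[OF S]
  proof
    fix x assume x: "x \<in> insert 0 S \<inter> {..t}"
    then have x0: "0 \<le> x" "x \<le> t" using S by (auto simp: locally_finite_points_def)
    have "\<exists>q\<in>insert t (\<rat> \<inter> {0..t}). x \<le> q \<and> q < x + 1 / Suc k"
    proof (cases "x = t")
      case True then show ?thesis using k0 by auto
    next
      case False
      then have "x < min t (x + 1 / Suc k)" using x0 k0 by linarith
      then obtain q where "q \<in> \<rat>" "x < q" "q < min t (x + 1 / Suc k)"
        using Rats_dense_in_real by blast
      then show ?thesis using x0 by (intro bexI[of _ q]) auto
    qed
    then obtain q where q: "q \<in> insert t (\<rat> \<inter> {0..t})" "x \<le> q" "q < x + 1 / Suc k" by blast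
    obtain y where "y \<in> S" "q < y" "y \<le> q + L - 1 / Suc k" using k[OF q(1)] by auto
    then show "\<exists>y\<in>S. x < y \<and> y < x + L" using q by (intro bexI[of _ y]) auto
  qed
qed

text \<open>
  The windows are short and sit at the ends of consecutive blocks of length \<open>c\<close>. From any point
  before the end, the first window that lies completely to its right ends less than \<open>c + d\<close> later.
  This sufficient condition for \<open>D > t\<close> uses only one point per length \<open>c\<close>, where \<open>c\<close> may be
  chosen as close to \<open>c + d\<close> as desired.
\<close>
lemma windows_nonempty_imp_first_gap_gt:
  assumes S: "locally_finite_points S" and d: "0 < d" "d < c"
    and ne: "\<And>i. i < n \<Longrightarrow> S \<inter> {real (Suc i) * c - d<..real (Suc i) * c} \<noteq> {}"
    and t: "t < real n * c - d"
  shows "first_gap (c + d) S > ereal t"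
  unfolding first_gap_gt_iff[OF S]
proof
  fix x assume x: "x \<in> insert 0 S \<inter> {..t}"
  then have x0: "0 \<le> x" "x \<le> t" using S by (auto simp: locally_finite_points_def)
  \<comment> \<open>\<open>m\<close> is the index of the first window that does not start before \<open>x\<close>; \<open>m = 0\<close> is excluded
    because \<open>- d < 0 \<le> x\<close>\<close>
  let ?P = "\<lambda>m. x \<le> real m * c - d"
  define m where "m = (LEAST m. ?P m)"
  have Pn: "?P n" using x0 t by simp
  have Pm: "?P m" unfolding m_def by (rule LeastI[of ?P, OF Pn])
  have mn: "m \<le> n" unfolding m_def by (rule Least_le[of ?P, OF Pn])
  have "m \<noteq> 0" using Pm x0 d by (cases m) auto
  then obtain i where i: "m = Suc i" by (cases m) auto
  have "\<not> ?P i" unfolding m_def using i by (metis lessI m_def not_less_Least)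
  then have *: "real i * c < x + d" by simp
  obtain y where y: "y \<in> S" "real (Suc i) * c - d < y" "y \<le> real (Suc i) * c"
    using ne[of i] i mn by auto
  have "real (Suc i) * c = real i * c + c" by (simp add: algebra_simps)
  then have "y < x + (c + d)" using * y by linarith
  moreover have "x < y" using Pm y i by auto
  ultimately show "\<exists>y\<in>S. x < y \<and> y < x + (c + d)" using y(1) by blast
qed

section \<open>Uniform convergence for regularly varying functions\<close>

lemma lmeasurable_near:
  fixes h g :: "real \<Rightarrow> real"
  assumes [measurable]: "h \<in> borel_measurable lebesgue" "g \<in> borel_measurable lebesgue"
  shows "{y\<in>{a..b}. \<bar>h y - g y\<bar> < e} \<in> lmeasurable"
proof -
  have "{y\<in>space lebesgue. \<bar>h y - g y\<bar> < e} \<in> sets lebesgue" by measurable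
  then have "{a..b} \<inter> {y\<in>space lebesgue. \<bar>h y - g y\<bar> < e} \<in> lmeasurable"
    by (intro fmeasurable_Int_fmeasurable) auto
  moreover have "{a..b} \<inter> {y\<in>space lebesgue. \<bar>h y - g y\<bar> < e} = {y\<in>{a..b}. \<bar>h y - g y\<bar> < e}"
    by auto
  ultimately show ?thesis by simp
qed

text \<open>
  Dominated convergence of the indicators. It turns the pointwise limits in the definition of
  regular variation into sets of almost full measure on which the error is small.
\<close>
lemma measure_convergence_in_measure:
  fixes h :: "nat \<Rightarrow> real \<Rightarrow> real" and g :: "real \<Rightarrow> real"
  assumes h[measurable]: "\<And>n. h n \<in> borel_measurable lebesgue"
    and g[measurable]: "g \<in> borel_measurable lebesgue"
    and lim: "\<And>y. y \<in> {a..b} \<Longrightarrow> (\<lambda>n. h n y) \<longlonglongrightarrow> g y" and e: "0 < e" and ab: "a \<le> b"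
  shows "(\<lambda>n. measure lebesgue {y\<in>{a..b}. \<bar>h n y - g y\<bar> < e}) \<longlonglongrightarrow> b - a"
proof -
  let ?V = "\<lambda>n. {y\<in>{a..b}. \<bar>h n y - g y\<bar> < e}"
  have V[measurable]: "?V n \<in> sets lebesgue" for n
    using lmeasurable_near[OF h g] by (rule fmeasurableD)
  have "(\<lambda>n. integral\<^sup>L lebesgue (indicat_real (?V n))) \<longlonglongrightarrow> integral\<^sup>L lebesgue (indicat_real {a..b})"
  proof (rule integral_dominated_convergence[where w = "indicat_real {a..b}"
        and f = "indicat_real {a..b}" and s = "\<lambda>n. indicat_real (?V n)"])
    show "integrable lebesgue (indicat_real {a..b})"
      using lmeasurable_iff_integrable[of "{a..b}"] by auto
    show "AE y in lebesgue. (\<lambda>n. indicat_real (?V n) y) \<longlonglongrightarrow> indicat_real {a..b} y"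
    proof (rule AE_I2)
      fix y :: real
      show "(\<lambda>n. indicat_real (?V n) y) \<longlonglongrightarrow> indicat_real {a..b} y"
      proof (cases "y \<in> {a..b}")
        case True
        have "\<forall>\<^sub>F n in sequentially. dist (h n y) (g y) < e"
          using lim[OF True] e by (rule tendstoD)
        then have "\<forall>\<^sub>F n in sequentially. indicat_real (?V n) y = indicat_real {a..b} y"
          by eventually_elim (use True in \<open>auto simp: dist_real_def indicator_def\<close>)
        then show ?thesis by (rule tendsto_eventually)
      qed auto
    qed
    show "AE y in lebesgue. norm (indicat_real (?V n) y) \<le> indicat_real {a..b} y" for n
      by (auto simp: indicator_def)
    show "indicat_real {a..b} \<in> borel_measurable lebesgue"
      by (intro borel_measurable_indicator) auto
    show "indicat_real (?V n) \<in> borel_measurable lebesgue" for n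
      by (rule borel_measurable_indicator[OF V])
  qed
  then show ?thesis using ab by simp
qed

text \<open>
  \<open>V\<close> fills more than four fifths of \<open>{1/2..3}\<close>. The dilation of \<open>W\<close> by \<open>u\<close> lies in the same interval
  and has measure at least \<open>(9/10)\<^sup>2 > 1/2\<close>, which is too much for it to avoid \<open>V\<close>.
\<close>
lemma dilation_meets:
  fixes u :: real
  assumes V: "V \<in> lmeasurable" "V \<subseteq> {1/2..3}" "2 < measure lebesgue V"
    and W: "W \<in> lmeasurable" "W \<subseteq> {1..2}" "9/10 < measure lebesgue W"
    and u: "9/10 < u" "u < 11/10"
  obtains w where "w \<in> W" "u * w \<in> V"
proof -
  let ?uW = "(\<lambda>y. u *\<^sub>R y + 0) ` W"
  have "?uW = (*\<^sub>R) (1 / u) -` W \<inter> space lebesgue"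
    using u by (force simp: image_iff)
  then have "?uW \<in> sets lebesgue"
    using measurable_sets[OF lebesgue_measurable_scaling fmeasurableD[OF W(1)], of "1 / u"] by simp
  moreover have "emeasure lebesgue ?uW < \<infinity>"
    using fmeasurableD2[OF W(1)]
    by (subst emeasure_lebesgue_affine) (simp add: ennreal_mult_less_top top.not_eq_extremum)
  ultimately have uW_m: "?uW \<in> lmeasurable" by (auto intro: fmeasurableI)
  have "9/10 * (9/10) \<le> u * measure lebesgue W"
    using W u by (intro mult_mono) auto
  then have uW: "81/100 \<le> measure lebesgue ?uW"
    using u by (subst measure_lebesgue_affine) auto
  have "V \<inter> ?uW \<noteq> {}"
  proof
    assume disj: "V \<inter> ?uW = {}"
    have "u * y \<in> {1/2..3}" if "y \<in> {1..2}" for y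
    proof -
      have "9/10 * 1 \<le> u * y" using that u by (intro mult_mono) auto
      moreover have "u * y \<le> 11/10 * 2" using that u by (intro mult_mono) auto
      ultimately show ?thesis by simp
    qed
    then have sub: "V \<union> ?uW \<subseteq> {1/2..3}" using V W by auto
    have "measure lebesgue V + measure lebesgue ?uW = measure lebesgue (V \<union> ?uW)"
      using measure_Un3[OF V(1) uW_m] disj by simp
    also have "\<dots> \<le> measure lebesgue {1/2..3::real}"
      using V uW_m sub by (intro measure_mono_fmeasurable) auto
    also have "\<dots> = 5/2" by simp
    finally show False using V(3) uW by simp
  qed
  then show thesis using that by auto
qed

text \<open>
  The local form of the uniform convergence theorem for regularly varying functions, in logarithmic
  scale. For each \<open>n\<close> one compares \<open>G (u n * x n)\<close> and \<open>G (x n)\<close> through a third value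
  \<open>G (u n * w * x n)\<close>. The pointwise limit controls both comparisons except for \<open>w\<close> in a set of small
  measure, and measure counting provides a \<open>w\<close> that is good for both.
\<close>
lemma log_regular_variation_uniform:
  fixes G :: "real \<Rightarrow> real"
  assumes G[measurable]: "G \<in> borel_measurable lebesgue"
    and lim: "\<And>y. 0 < y \<Longrightarrow> ((\<lambda>t. G (y * t) - G t) \<longlongrightarrow> \<alpha> * ln y) at_top"
    and x: "filterlim x at_top sequentially" and u: "u \<longlonglongrightarrow> 1"
  shows "(\<lambda>n. G (u n * x n) - G (x n)) \<longlonglongrightarrow> 0"
proof (rule tendstoI)
  fix r :: real assume r: "0 < r"
  \<comment> \<open>three errors of size at most \<open>e\<close> add up: two comparisons and \<open>\<alpha> * ln (u n)\<close>\<close>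
  define e where "e = r / 4"
  have e: "0 < e" using r by (simp add: e_def)
  have [measurable]: "(\<lambda>y. G (y * s)) \<in> borel_measurable lebesgue" for s
  proof -
    have "(\<lambda>y. G (s *\<^sub>R y)) \<in> borel_measurable lebesgue" by measurable
    then show ?thesis by (simp add: mult.commute)
  qed
  have [measurable]: "(\<lambda>y. \<alpha> * ln y) \<in> borel_measurable lebesgue"
    by (rule measurable_completion) measurable
  define V where "V = (\<lambda>n. {y\<in>{1/2..3}. \<bar>(G (y * x n) - G (x n)) - \<alpha> * ln y\<bar> < e})"
  define W where
    "W = (\<lambda>n. {y\<in>{1..2}. \<bar>(G (y * (u n * x n)) - G (u n * x n)) - \<alpha> * ln y\<bar> < e})"
  have ux: "filterlim (\<lambda>n. u n * x n) at_top sequentially"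
    by (rule filterlim_tendsto_pos_mult_at_top[OF u _ x]) simp
  have V: "(\<lambda>n. measure lebesgue (V n)) \<longlonglongrightarrow> 3 - 1/2"
    unfolding V_def by (rule measure_convergence_in_measure)
       (use e in \<open>auto intro!: filterlim_compose[OF lim x]\<close>)
  have W: "(\<lambda>n. measure lebesgue (W n)) \<longlonglongrightarrow> 2 - 1"
    unfolding W_def by (rule measure_convergence_in_measure)
       (use e in \<open>auto intro!: filterlim_compose[OF lim ux]\<close>)
  have "(\<lambda>n. \<alpha> * ln (u n)) \<longlonglongrightarrow> \<alpha> * ln 1" by (intro tendsto_intros u) auto
  then have lnu: "\<forall>\<^sub>F n in sequentially. dist (\<alpha> * ln (u n)) (\<alpha> * ln 1) < e"
    using e by (rule tendstoD)
  have V_large: "\<forall>\<^sub>F n in sequentially. 2 < measure lebesgue (V n)"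
    by (rule order_tendstoD(1)[OF V]) simp
  have W_large: "\<forall>\<^sub>F n in sequentially. 9/10 < measure lebesgue (W n)"
    by (rule order_tendstoD(1)[OF W]) simp
  have u_near: "\<forall>\<^sub>F n in sequentially. 9/10 < u n" "\<forall>\<^sub>F n in sequentially. u n < 11/10"
    by (rule order_tendstoD[OF u]; simp)+
  show "\<forall>\<^sub>F n in sequentially. dist (G (u n * x n) - G (x n)) 0 < r"
    using V_large W_large u_near lnu
  proof eventually_elim
    case (elim n)
    have V_m: "V n \<in> lmeasurable" "V n \<subseteq> {1/2..3}"
      unfolding V_def by (rule lmeasurable_near; measurable) auto
    have W_m: "W n \<in> lmeasurable" "W n \<subseteq> {1..2}"
      unfolding W_def by (rule lmeasurable_near; measurable) auto
    obtain w where w: "w \<in> W n" "u n * w \<in> V n"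
      using dilation_meets[OF V_m elim(1) W_m elim(2-4)] by blast
    then have w1: "1 \<le> w" using W_m by auto
    have "ln (u n * w) = ln (u n) + ln w" using w1 elim(3) by (simp add: ln_mult)
    then have "\<alpha> * ln (u n * w) = \<alpha> * ln (u n) + \<alpha> * ln w" by (simp add: algebra_simps)
    moreover have "\<bar>G (u n * w * x n) - G (x n) - \<alpha> * ln (u n * w)\<bar> < e"
      using w(2) by (simp add: V_def)
    moreover have "\<bar>G (u n * w * x n) - G (u n * x n) - \<alpha> * ln w\<bar> < e"
      using w(1) by (simp add: W_def mult_ac)
    ultimately show ?case using elim(5) r unfolding e_def dist_real_def by (simp; arith)
  qed
qed

section \<open>Asymptotics of partial sums at block counts\<close>

text \<open>
  The hypothesis of regular variation only speaks of exact multiples of \<open>t\<close>. Block counts such as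
  \<open>\<lfloor>t / c\<rfloor>\<close> are multiples only up to a factor tending to \<open>1\<close>, and this is what the preceding lemma
  absorbs.
\<close>
lemma regularly_varying_tendsto:
  fixes f s :: "real \<Rightarrow> real"
  assumes rv: "regularly_varying f \<alpha>" and s: "((\<lambda>t. s t / t) \<longlongrightarrow> b) at_top" and b: "0 < b"
  shows "((\<lambda>t. f (s t) / f t) \<longlongrightarrow> b powr \<alpha>) at_top"
proof (rule tendsto_at_topI_sequentially)
  fix X :: "nat \<Rightarrow> real" assume X: "filterlim X at_top sequentially"
  obtain T where meas: "f \<in> borel_measurable (lebesgue_on {T..})" and pos: "\<And>t. T \<le> t \<Longrightarrow> 0 < f t"
    and lim: "\<And>x. 0 < x \<Longrightarrow> ((\<lambda>t. f (x * t) / f t) \<longlongrightarrow> x powr \<alpha>) at_top"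
    using rv unfolding regularly_varying_def by blast
  \<comment> \<open>\<open>f\<close> is measurable and positive only from \<open>T\<close> on\<close>
  define G where "G t = indicat_real {T..} t * ln (f t)" for t
  have G_eq: "G t = ln (f t)" if "T \<le> t" for t using that by (simp add: G_def)
  have "(\<lambda>t. ln (f t)) \<in> borel_measurable (lebesgue_on {T..})" using meas by measurable
  then have G_meas: "G \<in> borel_measurable lebesgue"
    by (subst (asm) borel_measurable_restrict_space_iff) (auto simp: G_def[abs_def])
  have G_lim: "((\<lambda>t. G (y * t) - G t) \<longlongrightarrow> \<alpha> * ln y) at_top" if y: "0 < y" for y
  proof -
    have "((\<lambda>t. ln (f (y * t) / f t)) \<longlongrightarrow> ln (y powr \<alpha>)) at_top"
      by (rule tendsto_ln[OF lim[OF y]]) (use y in simp)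
    moreover have "\<forall>\<^sub>F t in at_top. T \<le> y * t"
      using filterlim_tendsto_pos_mult_at_top[OF tendsto_const y filterlim_ident]
      by (simp add: filterlim_at_top)
    then have "\<forall>\<^sub>F t in at_top. ln (f (y * t) / f t) = G (y * t) - G t"
      using eventually_ge_at_top[of T]
    proof eventually_elim
      case (elim t)
      then show ?case using pos[of t] pos[of "y * t"] by (simp add: G_eq ln_div)
    qed
    ultimately show ?thesis
      using y by (simp add: ln_powr tendsto_cong)
  qed
  define x where "x n = b * X n" for n
  define u where "u n = s (X n) / x n" for n
  have x: "filterlim x at_top sequentially"
    unfolding x_def by (rule filterlim_tendsto_pos_mult_at_top[OF tendsto_const b X])
  have "(\<lambda>n. (s (X n) / X n) / b) \<longlonglongrightarrow> b / b"
    by (intro tendsto_divide filterlim_compose[OF s X] tendsto_const) (use b in simp)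
  then have u: "u \<longlonglongrightarrow> 1" using b by (simp add: u_def[abs_def] x_def mult.commute)
  have ux: "filterlim (\<lambda>n. u n * x n) at_top sequentially"
    by (rule filterlim_tendsto_pos_mult_at_top[OF u _ x]) simp
  have "(\<lambda>n. exp (G (u n * x n) - G (x n))) \<longlonglongrightarrow> exp 0"
    by (rule tendsto_exp[OF log_regular_variation_uniform[OF G_meas G_lim x u]])
  moreover have "(\<lambda>n. f (b * X n) / f (X n)) \<longlonglongrightarrow> b powr \<alpha>"
    by (rule filterlim_compose[OF lim[OF b] X])
  ultimately have lim_prod:
    "(\<lambda>n. exp (G (u n * x n) - G (x n)) * (f (b * X n) / f (X n))) \<longlonglongrightarrow> exp 0 * b powr \<alpha>"
    by (rule tendsto_mult)
  have eq: "\<forall>\<^sub>F n in sequentially.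
      exp (G (u n * x n) - G (x n)) * (f (b * X n) / f (X n)) = f (s (X n)) / f (X n)"
  proof -
    have "\<forall>\<^sub>F n in sequentially. T \<le> u n * x n" "\<forall>\<^sub>F n in sequentially. max T 1 \<le> x n"
      using ux x unfolding filterlim_at_top by blast+
    then show ?thesis
    proof eventually_elim
      case (elim n)
      then have "u n * x n = s (X n)" by (simp add: u_def)
      then show ?case
        using elim pos[of "x n"] pos[of "u n * x n"]
        by (simp add: G_eq exp_diff x_def)
    qed
  qed
  show "(\<lambda>n. f (s (X n)) / f (X n)) \<longlonglongrightarrow> b powr \<alpha>"
    using Lim_transform_eventually[OF lim_prod eq] by simp
qed

lemma floor_count_over_tendsto:
  fixes c :: real
  assumes c: "0 < c"
  shows "((\<lambda>t. real (nat \<lfloor>t / c\<rfloor> + d) / t) \<longlongrightarrow> 1 / c) at_top"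
proof (rule tendsto_sandwich)
  have *: "((\<lambda>t. 1 / c + K / t) \<longlongrightarrow> 1 / c + 0) at_top" for K :: real
    by (intro tendsto_intros tendsto_divide_0[OF tendsto_const] filterlim_at_top_imp_at_infinity filterlim_ident)
  show "((\<lambda>t. 1 / c + (real d - 1) / t) \<longlongrightarrow> 1 / c) at_top" "((\<lambda>t. 1 / c + real d / t) \<longlongrightarrow> 1 / c) at_top"
    using *[of "real d - 1"] *[of "real d"] by simp_all
  have floor: "t / c - 1 \<le> real (nat \<lfloor>t / c\<rfloor>) \<and> real (nat \<lfloor>t / c\<rfloor>) \<le> t / c" if "0 < t" for t
  proof -
    have "0 \<le> t / c" using that c by simp
    then show ?thesis by linarith
  qed
  show "\<forall>\<^sub>F t in at_top. 1 / c + (real d - 1) / t \<le> real (nat \<lfloor>t / c\<rfloor> + d) / t"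
    using eventually_gt_at_top[of 0]
  proof eventually_elim
    case (elim t)
    have "1 / c + (real d - 1) / t = (t / c - 1 + real d) / t"
      using elim c by (simp add: add_divide_distrib diff_divide_distrib)
    also have "\<dots> \<le> real (nat \<lfloor>t / c\<rfloor> + d) / t"
      using elim floor[OF elim] by (intro divide_right_mono) auto
    finally show ?case .
  qed
  show "\<forall>\<^sub>F t in at_top. real (nat \<lfloor>t / c\<rfloor> + d) / t \<le> 1 / c + real d / t"
    using eventually_gt_at_top[of 0]
  proof eventually_elim
    case (elim t)
    have "real (nat \<lfloor>t / c\<rfloor> + d) / t \<le> (t / c + real d) / t"
      using elim floor[OF elim] by (intro divide_right_mono) auto
    also have "\<dots> = 1 / c + real d / t"
      using elim c by (simp add: add_divide_distrib)
    finally show ?case .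
  qed
qed

text \<open>
  The logarithm of the probability of hitting all windows will be such a partial sum with an affine
  error. The error vanishes since \<open>t / f t\<close> tends to \<open>0\<close>, and the exponent \<open>\<rho> - \<alpha>\<close> arises because
  \<open>c powr \<rho>\<close> meets \<open>f (t / c) / f t\<close>, which tends to \<open>c powr (- \<alpha>)\<close>.
\<close>
lemma partial_sum_at_floor_tendsto:
  fixes f :: "real \<Rightarrow> real" and A :: "nat \<Rightarrow> real"
  assumes rv: "regularly_varying f \<alpha>" and tf: "((\<lambda>t. t / f t) \<longlongrightarrow> 0) at_top"
    and A: "A \<sim>[sequentially] (\<lambda>n. - (c powr \<rho>) * f (real n))" and c: "0 < c"
  shows "((\<lambda>t. (C + K * real (nat \<lfloor>t / c\<rfloor> + d) + A (nat \<lfloor>t / c\<rfloor> + d)) / f t)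
    \<longlongrightarrow> - (c powr (\<rho> - \<alpha>))) at_top"
proof -
  define m where "m t = nat \<lfloor>t / c\<rfloor> + d" for t
  obtain T where pos: "\<And>t. T \<le> t \<Longrightarrow> 0 < f t" using rv unfolding regularly_varying_def by blast
  have m_over: "((\<lambda>t. real (m t) / t) \<longlongrightarrow> 1 / c) at_top"
    unfolding m_def by (rule floor_count_over_tendsto[OF c])
  have "filterlim (\<lambda>t. real (m t) / t * t) at_top at_top"
    by (rule filterlim_tendsto_pos_mult_at_top[OF m_over _ filterlim_ident]) (use c in simp)
  moreover have "\<forall>\<^sub>F t in at_top. real (m t) / t * t = real (m t)"
    using eventually_gt_at_top[of 0] by eventually_elim simp
  ultimately have m_real: "filterlim (\<lambda>t. real (m t)) at_top at_top"
    by (simp add: filterlim_cong)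
  then have m_top: "filterlim m sequentially at_top"
    by (simp add: filterlim_sequentially_iff_filterlim_real)
  have f_ratio: "((\<lambda>t. f (real (m t)) / f t) \<longlongrightarrow> (1 / c) powr \<alpha>) at_top"
    by (rule regularly_varying_tendsto[OF rv m_over]) (use c in simp)
  have "((\<lambda>t. A (m t) / (- (c powr \<rho>) * f (real (m t)))) \<longlongrightarrow> 1) at_top"
  proof -
    have "((\<lambda>t. (if A (m t) = 0 \<and> - (c powr \<rho>) * f (real (m t)) = 0 then 1
        else A (m t) / (- (c powr \<rho>) * f (real (m t))))) \<longlongrightarrow> 1) at_top"
      by (rule filterlim_compose[OF asymp_equivD[OF A] m_top])
    moreover have "\<forall>\<^sub>F t in at_top. T \<le> real (m t)"
      using m_real by (simp add: filterlim_at_top)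
    then have "\<forall>\<^sub>F t in at_top. (if A (m t) = 0 \<and> - (c powr \<rho>) * f (real (m t)) = 0 then 1
        else A (m t) / (- (c powr \<rho>) * f (real (m t)))) = A (m t) / (- (c powr \<rho>) * f (real (m t)))"
    proof eventually_elim
      case (elim t)
      then have "f (real (m t)) \<noteq> 0" using pos by fastforce
      then show ?case using c by simp
    qed
    ultimately show ?thesis by (simp only: tendsto_cong)
  qed
  then have lim_prod:
    "((\<lambda>t. A (m t) / (- (c powr \<rho>) * f (real (m t))) * (- (c powr \<rho>) * (f (real (m t)) / f t)))
      \<longlongrightarrow> 1 * (- (c powr \<rho>) * (1 / c) powr \<alpha>)) at_top"
    by (intro tendsto_mult tendsto_const f_ratio)
  have index: "1 * (- (c powr \<rho>) * (1 / c) powr \<alpha>) = - (c powr (\<rho> - \<alpha>))"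
    using c by (simp add: powr_diff powr_divide)
  have eq: "\<forall>\<^sub>F t in at_top.
      A (m t) / (- (c powr \<rho>) * f (real (m t))) * (- (c powr \<rho>) * (f (real (m t)) / f t)) = A (m t) / f t"
  proof -
    have "\<forall>\<^sub>F t in at_top. T \<le> real (m t)" using m_real by (simp add: filterlim_at_top)
    then show ?thesis
    proof eventually_elim
      case (elim t)
      then have "f (real (m t)) \<noteq> 0" using pos by fastforce
      then show ?case using c by simp
    qed
  qed
  have main: "((\<lambda>t. A (m t) / f t) \<longlongrightarrow> - (c powr (\<rho> - \<alpha>))) at_top"
    using Lim_transform_eventually[OF lim_prod eq] unfolding index .
  have lim_prod: "((\<lambda>t. (C / t + K * (real (m t) / t)) * (t / f t)) \<longlongrightarrow> (0 + K * (1 / c)) * 0) at_top"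
    by (intro tendsto_intros tf m_over tendsto_divide_0[OF tendsto_const]
        filterlim_at_top_imp_at_infinity filterlim_ident)
  have eq: "\<forall>\<^sub>F t in at_top. (C / t + K * (real (m t) / t)) * (t / f t) = (C + K * real (m t)) / f t"
    using eventually_gt_at_top[of 0]
  proof eventually_elim
    case (elim t)
    have "C / t + K * (real (m t) / t) = (C + K * real (m t)) / t" by (simp add: add_divide_distrib)
    then show ?case using elim by simp
  qed
  have "((\<lambda>t. (C + K * real (m t)) / f t) \<longlongrightarrow> 0) at_top"
    using Lim_transform_eventually[OF lim_prod eq] by simp
  from tendsto_add[OF this main] show ?thesis
    by (simp add: m_def add_divide_distrib)
qed

text \<open>
  Comparisons of single blocks are valid only far out, where \<open>\<mu>\<close> is monotone and small; the finitely
  many early blocks contribute a constant.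
\<close>
lemma sum_le_of_eventually_le:
  fixes a b :: "nat \<Rightarrow> real"
  assumes le: "\<And>i. i0 \<le> i \<Longrightarrow> a i \<le> K + b i"
  shows "\<exists>C. \<forall>n. (\<Sum>i<n. a i) \<le> C + K * real n + (\<Sum>i<n. b i)"
proof (intro exI allI)
  define e where "e i = max 0 (a i - K - b i)" for i
  fix n
  have e0: "e i = 0" if "i0 \<le> i" for i using le[OF that] by (simp add: e_def)
  have "(\<Sum>i<n. a i) - K * real n - (\<Sum>i<n. b i) = (\<Sum>i<n. a i - K - b i)"
    by (simp add: sum_subtractf)
  also have "\<dots> \<le> (\<Sum>i<n. e i)" by (intro sum_mono) (simp add: e_def)
  also have "\<dots> \<le> (\<Sum>i<max n i0. e i)" by (intro sum_mono2) (auto simp: e_def)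
  also have "\<dots> = (\<Sum>i<i0. e i)" by (intro sum.mono_neutral_right) (auto intro: e0)
  finally show "(\<Sum>i<n. a i) \<le> (\<Sum>i<i0. e i) + K * real n + (\<Sum>i<n. b i)" by simp
qed

section \<open>Hitting events of a Poisson process\<close>

lemma num_points_eq_0_iff: "num_points S B = 0 \<longleftrightarrow> S \<inter> B = {}"
  by (simp add: num_points_def emeasure_count_space_eq_0)

lemma poisson_locally_finite:
  "poisson_process P N \<mu> \<Longrightarrow> \<omega> \<in> space P \<Longrightarrow> locally_finite_points (N \<omega>)"
  by (auto simp: poisson_process_def locally_finite_points_def)

lemma poisson_hit_measurable:
  assumes pp: "poisson_process P N \<mu>" and B: "B \<in> sets borel" "B \<subseteq> {0<..}"
  shows "{\<omega>\<in>space P. N \<omega> \<inter> B \<noteq> {}} \<in> sets P"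
proof -
  have [measurable]: "(\<lambda>\<omega>. num_points (N \<omega>) B) \<in> borel_measurable P"
    using pp B by (simp add: poisson_process_def)
  have "{\<omega>\<in>space P. num_points (N \<omega>) B \<noteq> 0} \<in> sets P" by measurable
  then show ?thesis by (simp add: num_points_eq_0_iff)
qed

lemma poisson_hit_prob:
  assumes pp: "poisson_process P N \<mu>" and B: "B \<in> sets borel" "B \<subseteq> {0<..}"
    and fin: "intensity \<mu> B < \<infinity>"
  shows "measure P {\<omega>\<in>space P. N \<omega> \<inter> B \<noteq> {}} = 1 - exp (- enn2real (intensity \<mu> B))"
proof -
  interpret prob_space P using pp by (simp add: poisson_process_def)
  have "\<forall>k::nat. measure P {\<omega> \<in> space P. num_points (N \<omega>) B = of_nat k} =
       enn2real (intensity \<mu> B) ^ k / fact k * exp (- enn2real (intensity \<mu> B))"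
    using pp B fin unfolding poisson_process_def by blast
  from this[rule_format, of 0]
  have "prob {\<omega>\<in>space P. num_points (N \<omega>) B = 0} = exp (- enn2real (intensity \<mu> B))" by simp
  then have none: "prob {\<omega>\<in>space P. N \<omega> \<inter> B = {}} = exp (- enn2real (intensity \<mu> B))"
    by (simp add: num_points_eq_0_iff)
  have "{\<omega>\<in>space P. N \<omega> \<inter> B = {}} = space P - {\<omega>\<in>space P. N \<omega> \<inter> B \<noteq> {}}" by auto
  with none prob_compl[OF poisson_hit_measurable[OF pp B]] show ?thesis by simp
qed

lemma poisson_hit_all_prob:
  assumes pp: "poisson_process P N \<mu>"
    and B: "\<And>i. B i \<in> sets borel" "\<And>i. B i \<subseteq> {0<..}" "disjoint_family (B :: nat \<Rightarrow> real set)"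
    and fin: "\<And>i. intensity \<mu> (B i) < \<infinity>"
  shows "measure P {\<omega>\<in>space P. \<forall>i<n. N \<omega> \<inter> B i \<noteq> {}} =
    (\<Prod>i<n. 1 - exp (- enn2real (intensity \<mu> (B i))))"
proof (cases "n = 0")
  case True
  interpret prob_space P using pp by (simp add: poisson_process_def)
  show ?thesis using True by (simp add: prob_space)
next
  case False
  interpret prob_space P using pp by (simp add: poisson_process_def)
  have "\<forall>B :: nat \<Rightarrow> real set. (\<forall>i. B i \<in> sets borel \<and> B i \<subseteq> {0<..}) \<and> disjoint_family B \<longrightarrow>
        indep_vars (\<lambda>_. borel) (\<lambda>i \<omega>. num_points (N \<omega>) (B i)) UNIV"
    using pp unfolding poisson_process_def by blast
  then have indep: "indep_vars (\<lambda>_. borel) (\<lambda>i \<omega>. num_points (N \<omega>) (B i)) UNIV"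
    using B by blast
  have hit: "(\<lambda>\<omega>. num_points (N \<omega>) (B i)) -` (- {0}) \<inter> space P = {\<omega>\<in>space P. N \<omega> \<inter> B i \<noteq> {}}" for i
    by (auto simp: num_points_eq_0_iff)
  have "{\<omega>\<in>space P. \<forall>i<n. N \<omega> \<inter> B i \<noteq> {}} = (\<Inter>i\<in>{..<n}. {\<omega>\<in>space P. N \<omega> \<inter> B i \<noteq> {}})"
    using False by auto
  also have "prob \<dots> = (\<Prod>i<n. prob {\<omega>\<in>space P. N \<omega> \<inter> B i \<noteq> {}})"
    using indep_varsD[OF indep, of "{..<n}" "\<lambda>_. - {0}"] False unfolding hit by auto
  also have "\<dots> = (\<Prod>i<n. 1 - exp (- enn2real (intensity \<mu> (B i))))"
    by (intro prod.cong refl poisson_hit_prob[OF pp B(1,2) fin])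
  finally show ?thesis .
qed

lemma first_gap_event_measurable:
  assumes pp: "poisson_process P N \<mu>" and t: "0 \<le> t"
  shows "{\<omega>\<in>space P. first_gap L (N \<omega>) > ereal t} \<in> sets P"
proof -
  have [simp]: "{\<omega>\<in>space P. N \<omega> \<inter> {q<..q + L - 1 / Suc k} \<noteq> {}} \<in> sets P"
    if "q \<in> insert t (\<rat> \<inter> {0..t})" for q k
    using that t by (intro poisson_hit_measurable[OF pp]) auto
  have "countable (insert t (\<rat> \<inter> {0..t}))"
    by (intro countable_insert countable_Int1 countable_rat)
  then have "(\<Inter>q\<in>insert t (\<rat> \<inter> {0..t}). {\<omega>\<in>space P. N \<omega> \<inter> {q<..q + L - 1 / Suc k} \<noteq> {}})
      \<in> sets P" for k
    by (rule sets.countable_INT'[OF _ insert_not_empty]) (auto simp del: of_nat_Suc)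
  then have "(\<Union>k. \<Inter>q\<in>insert t (\<rat> \<inter> {0..t}).
      {\<omega>\<in>space P. N \<omega> \<inter> {q<..q + L - 1 / Suc k} \<noteq> {}}) \<in> sets P"
    by (intro sets.countable_UN) auto
  also have "(\<Union>k. \<Inter>q\<in>insert t (\<rat> \<inter> {0..t}). {\<omega>\<in>space P. N \<omega> \<inter> {q<..q + L - 1 / Suc k} \<noteq> {}})
      = {\<omega>\<in>space P. first_gap L (N \<omega>) > ereal t}"
  proof (rule set_eqI)
    fix \<omega>
    have "\<omega> \<in> space P \<Longrightarrow> first_gap L (N \<omega>) > ereal t \<longleftrightarrow>
      (\<exists>k. \<forall>q\<in>insert t (\<rat> \<inter> {0..t}). N \<omega> \<inter> {q<..q + L - 1 / Suc k} \<noteq> {})"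
      by (rule first_gap_gt_iff_windows[OF poisson_locally_finite[OF pp] t])
    then show "\<omega> \<in> (\<Union>k. \<Inter>q\<in>insert t (\<rat> \<inter> {0..t}).
        {\<omega>\<in>space P. N \<omega> \<inter> {q<..q + L - 1 / Suc k} \<noteq> {}}) \<longleftrightarrow>
      \<omega> \<in> {\<omega>\<in>space P. first_gap L (N \<omega>) > ereal t}"
      by (simp only: UN_iff INT_iff mem_Collect_eq) blast
  qed
  finally show ?thesis .
qed


section \<open>Bounds for the intensity of an interval\<close>

lemma not_AE_notin_interval:
  fixes a b :: real
  assumes "a < b" shows "\<not> (AE t in lebesgue. t \<notin> {a<..b})"
proof
  assume "AE t in lebesgue. t \<notin> {a<..b}"
  then have "{a<..b} \<in> null_sets lebesgue" by (subst AE_iff_null_sets) auto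
  then have "emeasure lebesgue {a<..b} = 0" by auto
  then show False using assms by simp
qed

text \<open>
  A non-positive value of an eventually non-increasing rate would persist on a whole interval. So
  almost everywhere positivity holds at every late time, in particular at the grid points where
  logarithms are taken.
\<close>
lemma antimono_rate_pos:
  fixes \<mu> :: "real \<Rightarrow> real"
  assumes pos: "AE t in lebesgue. t \<ge> 0 \<longrightarrow> \<mu> t > 0" and anti: "antimono_on {t0..} \<mu>"
    and t: "t0 \<le> t" "0 \<le> t"
  shows "0 < \<mu> t"
proof (rule ccontr)
  assume "\<not> 0 < \<mu> t"
  have "AE s in lebesgue. s \<notin> {t<..t + 1}"
    using pos
  proof eventually_elim
    case (elim s)
    show ?case
    proof
      assume s: "s \<in> {t<..t + 1}"
      then have "\<mu> s \<le> \<mu> t" using anti t by (auto simp: monotone_on_def)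
      then show False using elim s t \<open>\<not> 0 < \<mu> t\<close> by auto
    qed
  qed
  then show False using not_AE_notin_interval[of t "t + 1"] by simp
qed

lemma intensity_pos:
  assumes rate: "rate_function \<mu>" and pos: "AE t in lebesgue. t \<ge> 0 \<longrightarrow> \<mu> t > 0"
    and ab: "0 \<le> a" "a < b"
  shows "0 < intensity \<mu> {a<..b}"
proof (rule ccontr)
  assume "\<not> ?thesis"
  then have "intensity \<mu> {a<..b} = 0" by simp
  define g where "g t = indicat_real {0<..} t * \<mu> t" for t
  have [measurable]: "g \<in> borel_measurable lebesgue"
    using rate unfolding rate_function_def g_def[abs_def]
    by (subst (asm) borel_measurable_restrict_space_iff) auto
  have [measurable]: "{a<..b} \<in> sets lebesgue" by auto
  have "intensity \<mu> {a<..b} = (\<integral>\<^sup>+ t. ennreal (g t) * indicator {a<..b} t \<partial>lebesgue)"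
    unfolding intensity_def using ab
    by (intro nn_integral_cong) (auto simp: g_def indicator_def)
  then have "(\<integral>\<^sup>+ t. ennreal (g t) * indicator {a<..b} t \<partial>lebesgue) = 0"
    using \<open>intensity \<mu> {a<..b} = 0\<close> by simp
  then have "AE t in lebesgue. ennreal (g t) * indicator {a<..b} t = 0"
    by (subst (asm) nn_integral_0_iff_AE) measurable
  with pos have "AE t in lebesgue. t \<notin> {a<..b}"
    by eventually_elim (use ab in \<open>auto simp: g_def indicator_def split: if_splits\<close>)
  then show False using not_AE_notin_interval[OF ab(2)] by simp
qed

lemma intensity_finite:
  assumes fin: "\<forall>t>0. intensity \<mu> {0<..t} < \<infinity>" and ab: "0 \<le> a"
  shows "intensity \<mu> {a<..b} < \<infinity>"
proof -
  have "intensity \<mu> {a<..b} \<le> intensity \<mu> {0<..max b 1}"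
    unfolding intensity_def using ab by (intro nn_integral_mono) (auto simp: indicator_def)
  also have "\<dots> < \<infinity>" using fin by auto
  finally show ?thesis .
qed

lemma intensity_le_left:
  assumes anti: "antimono_on {t0..} \<mu>" and t: "t0 \<le> a" "a \<le> b" and pos: "0 \<le> \<mu> a"
  shows "enn2real (intensity \<mu> {a<..b}) \<le> (b - a) * \<mu> a"
proof -
  have "intensity \<mu> {a<..b} \<le> (\<integral>\<^sup>+ s. ennreal (\<mu> a) * indicator {a<..b} s \<partial>lebesgue)"
    unfolding intensity_def
  proof (rule nn_integral_mono)
    fix s :: real
    show "ennreal (\<mu> s) * indicator {a<..b} s \<le> ennreal (\<mu> a) * indicator {a<..b} s"
    proof (cases "s \<in> {a<..b}")
      case True
      then have "\<mu> s \<le> \<mu> a" using anti t by (auto simp: monotone_on_def)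
      then show ?thesis by (auto intro: mult_right_mono ennreal_leI)
    qed simp
  qed
  also have "\<dots> = ennreal ((b - a) * \<mu> a)"
    using t pos by (subst nn_integral_cmult_indicator) (auto simp: ennreal_mult mult.commute)
  finally show ?thesis using t pos by (intro enn2real_leI) auto
qed

lemma intensity_ge_right:
  assumes anti: "antimono_on {t0..} \<mu>" and t: "t0 \<le> a" "a \<le> b" and pos: "0 \<le> \<mu> b"
    and fin: "intensity \<mu> {a<..b} < \<infinity>"
  shows "(b - a) * \<mu> b \<le> enn2real (intensity \<mu> {a<..b})"
proof -
  have "ennreal ((b - a) * \<mu> b) = (\<integral>\<^sup>+ s. ennreal (\<mu> b) * indicator {a<..b} s \<partial>lebesgue)"
    using t pos by (subst nn_integral_cmult_indicator) (auto simp: ennreal_mult mult.commute)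
  also have "\<dots> \<le> intensity \<mu> {a<..b}"
    unfolding intensity_def
  proof (rule nn_integral_mono)
    fix s :: real
    show "ennreal (\<mu> b) * indicator {a<..b} s \<le> ennreal (\<mu> s) * indicator {a<..b} s"
    proof (cases "s \<in> {a<..b}")
      case True
      then have "\<mu> b \<le> \<mu> s" using anti t by (auto simp: monotone_on_def)
      then show ?thesis by (auto intro: mult_right_mono ennreal_leI)
    qed simp
  qed
  finally have "enn2real (ennreal ((b - a) * \<mu> b)) \<le> enn2real (intensity \<mu> {a<..b})"
    using fin by (intro enn2real_mono) auto
  then show ?thesis using t pos by simp
qed

lemma half_le_one_minus_exp:
  fixes x :: real
  assumes "0 \<le> x" "x \<le> 1"
  shows "x / 2 \<le> 1 - exp (- x)"
proof -
  have "exp (- x) \<le> 1 / (1 + x)"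
    using exp_ge_add_one_self[of x] assms by (simp add: exp_minus divide_simps)
  moreover have "x / 2 \<le> 1 - 1 / (1 + x)"
    using assms mult_left_mono[OF assms(2) assms(1)] by (simp add: divide_simps algebra_simps)
  ultimately show ?thesis by linarith
qed

section \<open>Bounds for the tail of the first large gap\<close>

lemma disjoint_family_windows:
  fixes c d :: real
  assumes d: "0 \<le> d" "d \<le> c"
  shows "disjoint_family (\<lambda>i::nat. {real (Suc i) * c - d<..real (Suc i) * c})"
proof -
  have "{real (Suc i) * c - d<..real (Suc i) * c} \<inter> {real (Suc j) * c - d<..real (Suc j) * c} = {}"
    if "i < j" for i j :: nat
  proof -
    have "real (Suc i) \<le> real j" using that by simp
    then have "real (Suc i) * c \<le> real j * c" using d by (intro mult_right_mono) auto
    then have "real (Suc i) * c \<le> real (Suc j) * c - d" using d by (simp add: algebra_simps)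
    then show ?thesis by auto
  qed
  then show ?thesis
    unfolding disjoint_family_on_def by (metis inf_commute linorder_neqE_nat)
qed

lemma sum_ln_shift: "(\<Sum>i<n. ln (\<mu> (real (Suc i) * c))) = (\<Sum>i=1..n. ln (\<mu> (real i * c)))"
  using sum.atLeast1_atMost_eq[of "\<lambda>i. ln (\<mu> (real i * c))" n] by simp

text \<open>
  If \<open>D > t\<close> then each of the disjoint blocks of length \<open>L\<close> that start up to time \<open>t\<close> contains a point. A
  block is hit with probability \<open>1 - exp (- M) \<le> M\<close>, and for a late block \<open>M\<close> is at most \<open>L\<close> times the
  rate at its left end. The blocks start at \<open>L\<close> instead of \<open>0\<close>, so that these left ends are the grid
  points \<open>i * L\<close> with \<open>1 \<le> i\<close>.
\<close>
lemma tail_prob_upper: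
  assumes L: "L > 0" and pp: "poisson_process P N \<mu>"
    and fin: "\<forall>t>0. intensity \<mu> {0<..t} < \<infinity>"
    and rate: "rate_function \<mu>" and pos: "AE t in lebesgue. t \<ge> 0 \<longrightarrow> \<mu> t > 0"
    and anti: "antimono_on {t0..} \<mu>"
  obtains C where "\<And>t. 0 \<le> t \<Longrightarrow> 0 < measure P {\<omega>\<in>space P. first_gap L (N \<omega>) > ereal t} \<Longrightarrow>
    ln (measure P {\<omega>\<in>space P. first_gap L (N \<omega>) > ereal t}) \<le>
      C + ln L * real (nat \<lfloor>t / L\<rfloor>) + (\<Sum>i=1..nat \<lfloor>t / L\<rfloor>. ln (\<mu> (real i * L)))"
proof -
  interpret prob_space P using pp by (simp add: poisson_process_def)
  define B where "B i = {real (Suc i) * L<..real (Suc i) * L + L}" for i :: nat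
  define M where "M i = enn2real (intensity \<mu> (B i))" for i
  have B_eq: "B i = {real (Suc (Suc i)) * L - L<..real (Suc (Suc i)) * L}" for i
    by (simp add: B_def algebra_simps)
  have B_disj: "disjoint_family B"
  proof -
    have "disjoint_family (\<lambda>i::nat. {real (Suc i) * L - L<..real (Suc i) * L})"
      using L by (intro disjoint_family_windows) auto
    then have "disjoint_family_on (\<lambda>i::nat. {real (Suc i) * L - L<..real (Suc i) * L}) (range Suc)"
      by (rule disjoint_family_on_mono[rotated]) simp
    then show ?thesis unfolding disjoint_family_on_def B_eq by blast
  qed
  have B_sub: "B i \<subseteq> {0<..}" for i
  proof -
    have "0 \<le> real (Suc i) * L" using L by simp
    then show ?thesis unfolding B_def by (intro subsetI) (simp only: greaterThanAtMost_iff greaterThan_iff, linarith)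
  qed
  have B_fin: "intensity \<mu> (B i) < \<infinity>" for i
    unfolding B_def using L by (intro intensity_finite[OF fin]) simp
  have M_pos: "0 < M i" for i
    using intensity_pos[OF rate pos, of "real (Suc i) * L" "real (Suc i) * L + L"] L B_fin[of i]
    by (simp add: M_def B_def enn2real_positive_iff)
  obtain i0 :: nat where i0: "max t0 0 / L \<le> real i0" using real_arch_simple by blast
  have "ln (1 - exp (- M i)) \<le> ln L + ln (\<mu> (real (Suc i) * L))" if "i0 \<le> i" for i
  proof -
    have "max t0 0 / L \<le> real (Suc i)" using i0 that by linarith
    then have large: "max t0 0 \<le> real (Suc i) * L" using L by (simp add: divide_le_eq)
    then have \<mu>_pos: "0 < \<mu> (real (Suc i) * L)" by (intro antimono_rate_pos[OF pos anti]) auto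
    have "1 - exp (- M i) \<le> M i" using exp_ge_add_one_self[of "- M i"] by simp
    also have "\<dots> \<le> (real (Suc i) * L + L - real (Suc i) * L) * \<mu> (real (Suc i) * L)"
      unfolding M_def B_def using large L \<mu>_pos by (intro intensity_le_left[OF anti]) auto
    finally have "1 - exp (- M i) \<le> L * \<mu> (real (Suc i) * L)" by simp
    then have "ln (1 - exp (- M i)) \<le> ln (L * \<mu> (real (Suc i) * L))"
      using M_pos[of i] by (intro ln_mono) auto
    also have "\<dots> = ln L + ln (\<mu> (real (Suc i) * L))" using L \<mu>_pos by (intro ln_mult_pos)
    finally show ?thesis .
  qed
  then obtain C where C: "\<And>n. (\<Sum>i<n. ln (1 - exp (- M i))) \<le>
      C + ln L * real n + (\<Sum>i<n. ln (\<mu> (real (Suc i) * L)))"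
    using sum_le_of_eventually_le[of i0 "\<lambda>i. ln (1 - exp (- M i))" "ln L"
          "\<lambda>i. ln (\<mu> (real (Suc i) * L))"] by blast
  show thesis
  proof (rule that[of C])
    fix t :: real
    let ?E = "{\<omega>\<in>space P. first_gap L (N \<omega>) > ereal t}"
    let ?n = "nat \<lfloor>t / L\<rfloor>"
    assume t: "0 \<le> t" and E_pos: "0 < prob ?E"
    have "0 \<le> t / L" using t L by simp
    then have "real ?n \<le> t / L" by linarith
    then have nt: "real ?n * L \<le> t" using L by (simp add: le_divide_eq)
    have sub: "?E \<subseteq> {\<omega>\<in>space P. \<forall>i<?n. N \<omega> \<inter> B i \<noteq> {}}"
    proof clarify
      fix \<omega> i assume \<omega>: "\<omega> \<in> space P" "first_gap L (N \<omega>) > ereal t" and i: "i < ?n"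
        and empty: "N \<omega> \<inter> B i = {}"
      obtain e where e: "0 < e" "\<And>q. 0 \<le> q \<Longrightarrow> q \<le> t \<Longrightarrow> N \<omega> \<inter> {q<..q + L - e} \<noteq> {}"
        using first_gap_gt_imp_windows_nonempty[OF poisson_locally_finite[OF pp \<omega>(1)] \<omega>(2) t] by blast
      have "real (Suc i) * L \<le> real ?n * L" using i L by (intro mult_right_mono) auto
      then have le_t: "real (Suc i) * L \<le> t" using nt by linarith
      have "N \<omega> \<inter> {real (Suc i) * L<..real (Suc i) * L + L - e} \<noteq> {}"
        using L by (intro e(2)[OF _ le_t]) simp
      moreover have "{real (Suc i) * L<..real (Suc i) * L + L - e} \<subseteq> B i"
        using e(1) by (auto simp: B_def)
      ultimately show False using empty by blast
    qed
    have "{\<omega>\<in>space P. \<forall>i<?n. N \<omega> \<inter> B i \<noteq> {}} \<in> events"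
    proof -
      have "{\<omega>\<in>space P. N \<omega> \<inter> B i \<noteq> {}} \<in> events" for i
        using B_sub by (intro poisson_hit_measurable[OF pp]) (auto simp: B_def)
      then show ?thesis by measurable
    qed
    then have "prob ?E \<le> prob {\<omega>\<in>space P. \<forall>i<?n. N \<omega> \<inter> B i \<noteq> {}}"
      by (rule finite_measure_mono[OF sub])
    also have "\<dots> = (\<Prod>i<?n. 1 - exp (- M i))"
      unfolding M_def by (rule poisson_hit_all_prob[OF pp _ B_sub B_disj B_fin]) (simp add: B_def)
    finally have "ln (prob ?E) \<le> ln (\<Prod>i<?n. 1 - exp (- M i))"
      using E_pos by (intro ln_mono) auto
    also have "\<dots> = (\<Sum>i<?n. ln (1 - exp (- M i)))"
      using less_imp_neq[OF M_pos] by (intro ln_prod) auto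
    also have "\<dots> \<le> C + ln L * real ?n + (\<Sum>i=1..?n. ln (\<mu> (real i * L)))"
      using C[of ?n] unfolding sum_ln_shift .
    finally show "ln (prob ?E) \<le> C + ln L * real ?n + (\<Sum>i=1..?n. ln (\<mu> (real i * L)))" .
  qed
qed

text \<open>
  Hitting all windows of length \<open>d\<close> that end at the multiples of \<open>c\<close> forces \<open>D > t\<close>. A late window has
  expected number of points at least \<open>d\<close> times the rate at its right end, a small number, and
  \<open>x / 2 \<le> 1 - exp (- x)\<close> turns this into a lower bound for the probability of hitting it. The
  number of blocks exceeds \<open>t / c\<close> by enough to reach past \<open>t + d\<close>.
\<close>
lemma tail_prob_lower:
  assumes d: "0 < d" "d < c" and pp: "poisson_process P N \<mu>"
    and fin: "\<forall>t>0. intensity \<mu> {0<..t} < \<infinity>"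
    and rate: "rate_function \<mu>" and pos: "AE t in lebesgue. t \<ge> 0 \<longrightarrow> \<mu> t > 0"
    and lim: "(\<mu> \<longlongrightarrow> 0) at_top" and anti: "antimono_on {t0..} \<mu>"
  obtains C where "\<And>t. 0 \<le> t \<Longrightarrow> 0 < measure P {\<omega>\<in>space P. first_gap (c + d) (N \<omega>) > ereal t}"
    "\<And>t. 0 \<le> t \<Longrightarrow>
      C + ln (d / 2) * real (nat \<lfloor>t / c\<rfloor> + 2) + (\<Sum>i=1..nat \<lfloor>t / c\<rfloor> + 2. ln (\<mu> (real i * c)))
      \<le> ln (measure P {\<omega>\<in>space P. first_gap (c + d) (N \<omega>) > ereal t})"
proof -
  interpret prob_space P using pp by (simp add: poisson_process_def)
  have c: "0 < c" using d by simp
  define B where "B i = {real (Suc i) * c - d<..real (Suc i) * c}" for i :: nat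
  define M where "M i = enn2real (intensity \<mu> (B i))" for i
  have B_disj: "disjoint_family B"
    unfolding B_def using d by (intro disjoint_family_windows) auto
  have left_pos: "0 < real (Suc i) * c - d" for i
  proof -
    have "1 * c \<le> real (Suc i) * c" using c by (intro mult_right_mono) auto
    then show ?thesis using d by linarith
  qed
  have B_sub: "B i \<subseteq> {0<..}" for i
    using left_pos[of i] by (auto simp: B_def)
  have B_fin: "intensity \<mu> (B i) < \<infinity>" for i
    unfolding B_def using left_pos[of i] by (intro intensity_finite[OF fin]) simp
  have M_pos: "0 < M i" for i
    using intensity_pos[OF rate pos, of "real (Suc i) * c - d" "real (Suc i) * c"] d left_pos[of i]
      B_fin[of i] by (simp add: M_def B_def enn2real_positive_iff)
  have "\<forall>\<^sub>F t in at_top. \<mu> t < 1 / d" using lim d by (intro order_tendstoD(2)) auto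
  then obtain t1 where t1: "\<And>t. t1 \<le> t \<Longrightarrow> \<mu> t < 1 / d" by (auto simp: eventually_at_top_linorder)
  obtain i0 :: nat where i0: "max (t0 + d) t1 / c \<le> real i0" using real_arch_simple by blast
  have "ln (\<mu> (real (Suc i) * c)) \<le> - ln (d / 2) + ln (1 - exp (- M i))" if "i0 \<le> i" for i
  proof -
    let ?x = "real (Suc i) * c"
    have "max (t0 + d) t1 / c \<le> real (Suc i)" using i0 that by linarith
    then have large: "max (t0 + d) t1 \<le> ?x" using c by (simp add: divide_le_eq)
    have \<mu>_pos: "0 < \<mu> ?x" using large d left_pos[of i] by (intro antimono_rate_pos[OF pos anti]) auto
    have \<mu>_le: "d * \<mu> ?x \<le> 1" using t1[of ?x] large d by (simp add: less_divide_eq mult.commute)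
    have "(?x - (?x - d)) * \<mu> ?x \<le> M i"
      unfolding M_def B_def using large d \<mu>_pos B_fin[of i]
      by (intro intensity_ge_right[OF anti]) (auto simp: B_def)
    then have "d * \<mu> ?x \<le> M i" by simp
    then have "1 - exp (- (d * \<mu> ?x)) \<le> 1 - exp (- M i)" by simp
    moreover have "d * \<mu> ?x / 2 \<le> 1 - exp (- (d * \<mu> ?x))"
      using d \<mu>_pos \<mu>_le by (intro half_le_one_minus_exp) auto
    ultimately have "d * \<mu> ?x / 2 \<le> 1 - exp (- M i)" by linarith
    then have "d / 2 * \<mu> ?x \<le> 1 - exp (- M i)" by (simp only: times_divide_eq_left)
    then have "ln (d / 2 * \<mu> ?x) \<le> ln (1 - exp (- M i))"
      using d \<mu>_pos by (intro ln_mono) auto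
    moreover have "ln (d / 2 * \<mu> ?x) = ln (d / 2) + ln (\<mu> ?x)"
      using d \<mu>_pos by (intro ln_mult_pos) auto
    ultimately show ?thesis by linarith
  qed
  then obtain C where C: "\<And>n. (\<Sum>i<n. ln (\<mu> (real (Suc i) * c))) \<le>
      C + - ln (d / 2) * real n + (\<Sum>i<n. ln (1 - exp (- M i)))"
    using sum_le_of_eventually_le[of i0 "\<lambda>i. ln (\<mu> (real (Suc i) * c))" "- ln (d / 2)"
          "\<lambda>i. ln (1 - exp (- M i))"] by blast
  have le: "(\<Prod>i<nat \<lfloor>t / c\<rfloor> + 2. 1 - exp (- M i))
      \<le> prob {\<omega>\<in>space P. first_gap (c + d) (N \<omega>) > ereal t}" if t: "0 \<le> t" for t
  proof -
    let ?E = "{\<omega>\<in>space P. first_gap (c + d) (N \<omega>) > ereal t}"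
    let ?n = "nat \<lfloor>t / c\<rfloor> + 2"
    have "t / c + 1 < real ?n" by linarith
    then have "(t / c + 1) * c < real ?n * c" using c by (intro mult_strict_right_mono)
    then have nt: "t < real ?n * c - d" using c d by (simp add: distrib_right)
    have "{\<omega>\<in>space P. \<forall>i<?n. N \<omega> \<inter> B i \<noteq> {}} \<subseteq> ?E"
      using windows_nonempty_imp_first_gap_gt[OF poisson_locally_finite[OF pp] d _ nt]
      by (auto simp: B_def)
    then have "prob {\<omega>\<in>space P. \<forall>i<?n. N \<omega> \<inter> B i \<noteq> {}} \<le> prob ?E"
      using first_gap_event_measurable[OF pp t] by (rule finite_measure_mono)
    moreover have "prob {\<omega>\<in>space P. \<forall>i<?n. N \<omega> \<inter> B i \<noteq> {}} = (\<Prod>i<?n. 1 - exp (- M i))"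
      unfolding M_def by (rule poisson_hit_all_prob[OF pp _ B_sub B_disj B_fin]) (simp add: B_def)
    ultimately show ?thesis by simp
  qed
  have prod_pos: "0 < (\<Prod>i<n. 1 - exp (- M i))" for n
    using M_pos by (intro prod_pos) auto
  show thesis
  proof (rule that[of "- C"])
    fix t :: real assume t: "0 \<le> t"
    let ?p = "prob {\<omega>\<in>space P. first_gap (c + d) (N \<omega>) > ereal t}"
    let ?n = "nat \<lfloor>t / c\<rfloor> + 2"
    show "0 < ?p" using le[OF t] prod_pos[of ?n] by linarith
    have "- C + ln (d / 2) * real ?n + (\<Sum>i=1..?n. ln (\<mu> (real i * c)))
        \<le> (\<Sum>i<?n. ln (1 - exp (- M i)))"
      using C[of ?n] unfolding sum_ln_shift by linarith
    also have "\<dots> = ln (\<Prod>i<?n. 1 - exp (- M i))"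
      using less_imp_neq[OF M_pos] by (intro ln_prod[symmetric]) auto
    also have "\<dots> \<le> ln ?p" using le[OF t] prod_pos by (rule ln_mono)
    finally show "- C + ln (d / 2) * real ?n + (\<Sum>i=1..?n. ln (\<mu> (real i * c))) \<le> ln ?p" .
  qed
qed


section \<open>Logarithmic asymptotics of the tail\<close>

theorem theorem5p1:
  fixes P :: "'a measure" and N :: "'a \<Rightarrow> real set"
    and \<mu> f :: "real \<Rightarrow> real" and L \<alpha> \<rho> :: real
  assumes "L > 0"
    and "rate_function \<mu>"
    and "\<forall>t>0. intensity \<mu> {0<..t} < \<infinity>"
    and "AE t in lebesgue. t \<ge> 0 \<longrightarrow> \<mu> t > 0"
    and "poisson_process P N \<mu>"
    and "(\<mu> \<longlongrightarrow> 0) at_top"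
    and "\<exists>t0. antimono_on {t0..} \<mu>"
    and "\<alpha> \<ge> 1"
    and "regularly_varying f \<alpha>"
    and "((\<lambda>t. t / f t) \<longlongrightarrow> 0) at_top"
    and "\<forall>c>0. (\<lambda>n. \<Sum>i=1..n. ln (\<mu> (real i * c))) \<sim>[sequentially]
                  (\<lambda>n. - (c powr \<rho>) * f (real n))"
  shows "log_equiv (\<lambda>t. measure P {\<omega> \<in> space P. first_gap L (N \<omega>) > ereal t})
                   (\<lambda>t. exp (- (L powr (\<rho> - \<alpha>)) * f t))"
proof -
  define p where "p t = measure P {\<omega>\<in>space P. first_gap L (N \<omega>) > ereal t}" for t
  define v where "v = L powr (\<rho> - \<alpha>)"
  have v: "0 < v" using assms(1) by (simp add: v_def)
  obtain t0 where anti: "antimono_on {t0..} \<mu>" using assms(7) by blast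
  obtain T where f_pos: "\<And>t. T \<le> t \<Longrightarrow> 0 < f t"
    using assms(9) unfolding regularly_varying_def by blast
  have lim_sum: "((\<lambda>t. (C + K * real (nat \<lfloor>t / c\<rfloor> + k) + (\<Sum>i=1..nat \<lfloor>t / c\<rfloor> + k. ln (\<mu> (real i * c)))) / f t)
      \<longlongrightarrow> - (c powr (\<rho> - \<alpha>))) at_top" if "0 < c" for c C K k
    using assms(11) that by (intro partial_sum_at_floor_tendsto[OF assms(9,10)]) auto
  have lower: "\<exists>C K. \<forall>t\<ge>0. 0 < p t \<and>
      C + K * real (nat \<lfloor>t / c\<rfloor> + 2) + (\<Sum>i=1..nat \<lfloor>t / c\<rfloor> + 2. ln (\<mu> (real i * c))) \<le> ln (p t)"
    if c: "L / 2 < c" "c < L" for c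
  proof -
    have d: "0 < L - c" "L - c < c" and L_eq: "c + (L - c) = L" using c by auto
    show ?thesis
    proof (rule tail_prob_lower[OF d assms(5,3,2,4,6) anti], unfold L_eq p_def[symmetric])
      fix C
      assume "\<And>t. 0 \<le> t \<Longrightarrow> 0 < p t" and "\<And>t. 0 \<le> t \<Longrightarrow>
        C + ln ((L - c) / 2) * real (nat \<lfloor>t / c\<rfloor> + 2)
          + (\<Sum>i=1..nat \<lfloor>t / c\<rfloor> + 2. ln (\<mu> (real i * c))) \<le> ln (p t)"
      then show ?thesis by (intro exI allI impI conjI)
    qed
  qed
  have p_pos: "0 < p t" if "0 \<le> t" for t
    using lower[of "3 / 4 * L"] assms(1) that by auto
  obtain C where upper: "\<And>t. 0 \<le> t \<Longrightarrow>
      ln (p t) \<le> C + ln L * real (nat \<lfloor>t / L\<rfloor>) + (\<Sum>i=1..nat \<lfloor>t / L\<rfloor>. ln (\<mu> (real i * L)))"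
  proof (rule tail_prob_upper[OF assms(1,5,3,2,4) anti], unfold p_def[symmetric])
    fix C
    assume le: "\<And>t. 0 \<le> t \<Longrightarrow> 0 < p t \<Longrightarrow>
      ln (p t) \<le> C + ln L * real (nat \<lfloor>t / L\<rfloor>) + (\<Sum>i=1..nat \<lfloor>t / L\<rfloor>. ln (\<mu> (real i * L)))"
    show thesis by (rule that[OF le[OF _ p_pos]])
  qed
  have "((\<lambda>t. ln (p t) / f t) \<longlongrightarrow> - v) at_top"
  proof (rule order_tendstoI)
    fix a assume a: "a < - v"
    \<comment> \<open>the lower bound for block length \<open>c\<close> has limit \<open>- (c powr (\<rho> - \<alpha>))\<close>; this exceeds \<open>a\<close>
      once \<open>c\<close> is close to \<open>L\<close>, and \<open>L / 2 < c\<close> keeps the windows disjoint\<close>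
    have "((\<lambda>c. - (c powr (\<rho> - \<alpha>))) \<longlongrightarrow> - (L powr (\<rho> - \<alpha>))) (at_left L)"
      using assms(1) by (intro tendsto_intros) auto
    then have "\<forall>\<^sub>F c in at_left L. a < - (c powr (\<rho> - \<alpha>))"
      using a unfolding v_def by (rule order_tendstoD(1))
    moreover have "\<forall>\<^sub>F c in at_left L. c \<in> {L / 2<..<L}"
      using assms(1) by (intro eventually_at_leftI[of "L / 2"]) auto
    ultimately have "\<forall>\<^sub>F c in at_left L. a < - (c powr (\<rho> - \<alpha>)) \<and> c \<in> {L / 2<..<L}"
      by eventually_elim auto
    then obtain c where c: "a < - (c powr (\<rho> - \<alpha>))" "L / 2 < c" "c < L"
      using eventually_happens'[OF trivial_limit_at_left_real] by force
    then obtain C K where CK: "\<And>t. 0 \<le> t \<Longrightarrow>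
        C + K * real (nat \<lfloor>t / c\<rfloor> + 2) + (\<Sum>i=1..nat \<lfloor>t / c\<rfloor> + 2. ln (\<mu> (real i * c))) \<le> ln (p t)"
      using lower[of c] by auto
    have "0 < c" using c assms(1) by simp
    from order_tendstoD(1)[OF lim_sum[OF this] c(1), of C K 2]
    show "\<forall>\<^sub>F t in at_top. a < ln (p t) / f t"
      using eventually_ge_at_top[of "max 0 T"]
    proof eventually_elim
      case (elim t)
      note elim(1)
      also have "(C + K * real (nat \<lfloor>t / c\<rfloor> + 2) + (\<Sum>i=1..nat \<lfloor>t / c\<rfloor> + 2. ln (\<mu> (real i * c)))) / f t
          \<le> ln (p t) / f t"
        using CK[of t] f_pos[of t] elim(2) by (intro divide_right_mono) auto
      finally show ?case .
    qed
  next
    fix a assume a: "- v < a"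
    from order_tendstoD(2)[OF lim_sum[OF assms(1)] a[unfolded v_def], of C "ln L" 0]
    show "\<forall>\<^sub>F t in at_top. ln (p t) / f t < a"
      using eventually_ge_at_top[of "max 0 T"]
    proof eventually_elim
      case (elim t)
      have "ln (p t) / f t \<le> (C + ln L * real (nat \<lfloor>t / L\<rfloor> + 0)
          + (\<Sum>i=1..nat \<lfloor>t / L\<rfloor> + 0. ln (\<mu> (real i * L)))) / f t"
        using upper[of t] f_pos[of t] elim(2) by (intro divide_right_mono) auto
      also note elim(1)
      finally show ?case .
    qed
  qed
  then have "((\<lambda>t. ln (p t) / f t / (- v)) \<longlongrightarrow> - v / (- v)) at_top"
    by (intro tendsto_intros) (use v in auto)
  then show ?thesis
    unfolding log_equiv_def p_def[symmetric] v_def[symmetric]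
    using v by (simp add: mult.commute)
qed

end
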